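(* Up to isomorphism, there is exactly one regular $2$-balanced $5$-partite tournament that has no strong partition.
   Context: A $2$-balanced $5$-partite tournament is an orientation of the complete $5$-partite graph with all parts of size $2$; it is regular if every vertex has in-degree equal to out-degree. A partition into maximal tournaments is a pair of vertex-disjoint tournaments of order $5$ covering all vertices (each containing one vertex from each partite set); it is a strong partition if both tournaments are strongly connected. *)

theory Defs
  imports "HOL-Library.Disjoint_Sets" "Graph_Theory.Graph_Theory"
begin

text \<open>
  Taking \<open>X = Y\<close> in the third conjunct says that there is no arc inside a part;
  in particular there are no loops.
\<close>
definition multipartite_tournament :: "'a pair_pre_digraph \<Rightarrow> 'a set set \<Rightarrow> bool" where
  "multipartite_tournament D P \<longleftrightarrow>
     pair_fin_digraph D \<and> partition_on (pverts D) P \<and>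
     (\<forall>X\<in>P. \<forall>Y\<in>P. \<forall>u\<in>X. \<forall>v\<in>Y.
        if X = Y then (u, v) \<notin> parcs D
        else ((u, v) \<in> parcs D) \<noteq> ((v, u) \<in> parcs D))"

definition balanced_partite_tournament :: "nat \<Rightarrow> nat \<Rightarrow> 'a pair_pre_digraph \<Rightarrow> bool" where
  "balanced_partite_tournament r c D \<longleftrightarrow>
     (\<exists>P. multipartite_tournament D P \<and> card P = c \<and> (\<forall>X\<in>P. card X = r))"

definition regular_digraph :: "'a pair_pre_digraph \<Rightarrow> bool" where
  "regular_digraph D \<longleftrightarrow>
     (\<forall>v\<in>pverts D. in_degree (with_proj D) v = out_degree (with_proj D) v)"

definition tournament :: "'a pair_pre_digraph \<Rightarrow> bool" where
  "tournament T \<longleftrightarrow>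
     pair_digraph T \<and>
     (\<forall>u\<in>pverts T. \<forall>v\<in>pverts T. u \<noteq> v \<longrightarrow>
        ((u, v) \<in> parcs T) \<noteq> ((v, u) \<in> parcs T))"

text \<open>
  Intended for a 2-balanced \<open>c\<close>-partite tournament \<open>D\<close>. Two vertices of one part of \<open>D\<close>
  are not adjacent, so a tournament of order \<open>c\<close> in \<open>D\<close> automatically has exactly one
  vertex in each part.
\<close>
definition maximal_tournament_partition ::
    "nat \<Rightarrow> 'a pair_pre_digraph \<Rightarrow> 'a pair_pre_digraph \<Rightarrow> 'a pair_pre_digraph \<Rightarrow> bool" where
  "maximal_tournament_partition c D A B \<longleftrightarrow>
     subgraph (with_proj A) (with_proj D) \<and> subgraph (with_proj B) (with_proj D) \<and>
     tournament A \<and> tournament B \<and>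
     card (pverts A) = c \<and> card (pverts B) = c \<and>
     pverts A \<inter> pverts B = {} \<and> pverts A \<union> pverts B = pverts D"

definition has_strong_partition :: "nat \<Rightarrow> 'a pair_pre_digraph \<Rightarrow> bool" where
  "has_strong_partition c D \<longleftrightarrow>
     (\<exists>A B. maximal_tournament_partition c D A B \<and>
        strongly_connected (with_proj A) \<and> strongly_connected (with_proj B))"

end

theory Submission
  imports Defs
begin

section \<open>Regular 2-balanced 5-partite tournaments without strong partition\<close>

text \<open>
  A tournament of order 5 fails to be strong iff it has a source or a sink, since no strong component
  has order 2. In the regular 5-partite tournament every vertex has out-degree 4, so it can be a
  source or a sink of a maximal tournament only if it sends exactly one arc to each other part
  (it is mixed). A mixed vertex spoils exactly 4 of the 32 choices of one vertex per part, and
  without a strong partition all 32 are spoiled. If both vertices of two parts are mixed, the arcs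
  between these parts form a directed 4-cycle; hence the two mixed vertices of a part spoil the same
  4 choices unless some part contains no mixed vertex. Counting then forces exactly one part to
  have no mixed vertex, while all other vertices are mixed. What remains is a tournament on four parts
  up to switching, and the spoiling condition determines it.
\<close>

subsection \<open>Arc patterns\<close>

text \<open>\<open>E i s j t\<close> is read as an arc from vertex \<open>s\<close> of part \<open>i\<close> to vertex \<open>t\<close> of part \<open>j\<close>.\<close>

locale regular_pattern =
  fixes E :: "nat \<Rightarrow> bool \<Rightarrow> nat \<Rightarrow> bool \<Rightarrow> bool"
  assumes irrefl: "i < 5 \<Longrightarrow> \<not> E i s i t"
    and anti: "\<lbrakk>i < 5; j < 5; i \<noteq> j\<rbrakk> \<Longrightarrow> E i s j t \<longleftrightarrow> \<not> E j t i s"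
    and out4: "i < 5 \<Longrightarrow> (\<Sum>j<5. of_bool (E i s j True) + of_bool (E i s j False)) = (4::nat)"

text \<open>
  A set \<open>c\<close> of parts encodes the maximal tournament picking vertex \<open>i \<in> c\<close> of each part \<open>i\<close>.
\<close>

definition extremal :: "(nat \<Rightarrow> bool \<Rightarrow> nat \<Rightarrow> bool \<Rightarrow> bool) \<Rightarrow> nat set \<Rightarrow> bool" where
  "extremal E c \<longleftrightarrow> (\<exists>i<5. \<exists>b. \<forall>j<5. j \<noteq> i \<longrightarrow> E i (i \<in> c) j (j \<in> c) = b)"

text \<open>
  Parts 0 to 3 form a tournament with source 0 and 3-cycle 1, 2, 3; an arc from \<open>i\<close> to \<open>j\<close>
  there stands for a directed 4-cycle through the parts \<open>i\<close> and \<open>j\<close>. Part 4 is joined uniformly: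
  its vertex \<open>True\<close> is dominated by parts 0, 1 and dominates parts 2, 3, and vice versa for \<open>False\<close>.
\<close>
definition canonical :: "nat \<Rightarrow> bool \<Rightarrow> nat \<Rightarrow> bool \<Rightarrow> bool" where
  "canonical i s j t \<longleftrightarrow> i \<noteq> j \<and>
     (if i = 4 then s \<noteq> (j < 2)
      else if j = 4 then t = (i < 2)
      else ((i, j) \<in> {(0, 1), (0, 2), (0, 3), (1, 2), (2, 3), (3, 1)}) = (s = t))"

text \<open>
  The four disjuncts say that a vertex in part 0, 1, 2, 3 blocks the choice \<open>x0, x1, x2, x3\<close>,
  where \<open>e\<close>, \<open>g\<close>, \<open>h\<close> are the orientations of the pairs 12, 13, 23 and part 0 is a source.
\<close>

lemma bool_cyclic:
  assumes "\<And>x0 x1 x2 x3. (x1 = x2 \<and> x2 = x3) \<or>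
    ((\<not> x0) = (e = x2) \<and> (e = x2) = (g = x3)) \<or>
    ((\<not> x0) = ((\<not> e) = x1) \<and> ((\<not> e) = x1) = (h = x3)) \<or>
    ((\<not> x0) = ((\<not> g) = x1) \<and> ((\<not> g) = x1) = ((\<not> h) = x2))"
  shows "g = (\<not> e) \<and> h = e"
proof -
  have "\<forall>x0 x1 x2 x3. (x1 = x2 \<and> x2 = x3) \<or>
    ((\<not> x0) = (e = x2) \<and> (e = x2) = (g = x3)) \<or>
    ((\<not> x0) = ((\<not> e) = x1) \<and> ((\<not> e) = x1) = (h = x3)) \<or>
    ((\<not> x0) = ((\<not> g) = x1) \<and> ((\<not> g) = x1) = ((\<not> h) = x2))"
    using assms by blast
  then show ?thesis by (cases e; cases g; cases h) (simp_all add: all_bool_eq)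
qed

section \<open>Mixed vertices and the choices they spoil\<close>

context regular_pattern begin

definition mixed :: "nat \<Rightarrow> bool \<Rightarrow> bool" where
  "mixed i s \<longleftrightarrow> (\<forall>j<5. j \<noteq> i \<longrightarrow> E i s j True \<noteq> E i s j False)"

definition out_choice :: "nat \<Rightarrow> bool \<Rightarrow> nat set" where
  "out_choice i s = {j. j < 5 \<and> j \<noteq> i \<and> E i s j True}"

definition in_choice :: "nat \<Rightarrow> bool \<Rightarrow> nat set" where
  "in_choice i s = {j. j < 5 \<and> j \<noteq> i \<and> \<not> E i s j True}"

text \<open>These are the choices \<open>c\<close> for which vertex \<open>s\<close> of part
  \<open>i\<close>, in whichever of the transversals of \<open>c\<close> and \<open>- c\<close>
  contains it, is a source or a sink. Complementing exchanges out-choice and in-choice, so both may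
  occur with and without \<open>i\<close>.\<close>

definition blocks :: "nat \<Rightarrow> bool \<Rightarrow> nat set set" where
  "blocks i s = (if mixed i s
     then {out_choice i s, insert i (out_choice i s), in_choice i s, insert i (in_choice i s)}
     else {})"

text \<open>
  A vertex that sends at least (or at most) one arc to each of the other four parts sends exactly
  one, because its out-degree is 4.
\<close>

lemma mixed_if_constant:
  assumes i: "i < 5" and const: "\<And>j. \<lbrakk>j < 5; j \<noteq> i\<rbrakk> \<Longrightarrow> E i s j (c j) = b"
  shows "mixed i s"
proof -
  let ?g = "\<lambda>j. of_bool (E i s j True) + of_bool (E i s j False) :: nat"
  have sum: "(\<Sum>j\<in>{..<5} - {i}. ?g j) = (\<Sum>j\<in>{..<5} - {i}. 1)"
    using out4[OF i, of s] i by (simp add: sum.remove[of _ i] irrefl)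
  have "?g j = 1" if j: "j \<in> {..<5} - {i}" for j
  proof (cases b)
    case True
    have "1 \<le> ?g k" if "k \<in> {..<5} - {i}" for k
      using const[of k] that True by (cases "c k") auto
    then show ?thesis
      using sum_mono_inv[OF sum[symmetric] _ j] by (metis finite_Diff finite_lessThan)
  next
    case False
    have "?g k \<le> 1" if "k \<in> {..<5} - {i}" for k
      using const[of k] that False by (cases "c k") auto
    then show ?thesis
      using sum_mono_inv[OF sum _ j] by (metis finite_Diff finite_lessThan)
  qed
  then have "E i s j True \<noteq> E i s j False" if "j < 5" "j \<noteq> i" for j
    using that by (fastforce simp: of_bool_def split: if_splits)
  then show ?thesis by (simp add: mixed_def)
qed

text \<open>A source or sink is mixed by \<open>mixed_if_constant\<close>, so its arcs determine the
  choice in the four other parts up to complement. Membership of \<open>i\<close> itself is free,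
  which the inserted variants in \<open>blocks\<close> absorb.\<close>

lemma extremal_imp_blocks:
  assumes "extremal E c \<or> extremal E (- c)" "c \<subseteq> {..<5}"
  shows "\<exists>i<5. \<exists>s. c \<in> blocks i s"
proof -
  obtain c' where c': "extremal E c'" "c' = c \<or> c' = - c" using assms by blast
  then obtain i b where i: "i < 5" and b: "\<And>j. \<lbrakk>j < 5; j \<noteq> i\<rbrakk> \<Longrightarrow> E i (i \<in> c') j (j \<in> c') = b"
    unfolding extremal_def by blast
  let ?s = "i \<in> c'"
  have m: "mixed i ?s" by (rule mixed_if_constant[OF i, of ?s "\<lambda>j. j \<in> c'" b]) (rule b)
  have E: "E i ?s j True \<longleftrightarrow> (j \<in> c') = b" if "j < 5" "j \<noteq> i" for j
  proof -
    have "E i ?s j True \<noteq> E i ?s j False" using m that by (simp add: mixed_def)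
    then show ?thesis using b[OF that] by (cases "j \<in> c'") auto
  qed
  \<comment> \<open>If the source or sink was found in the complement of \<open>c\<close>,
    membership in \<open>c\<close> is reversed; \<open>b'\<close> flips the direction
    \<open>b\<close> in that case.\<close>
  define b' where "b' \<longleftrightarrow> b = (c' = c)"
  have mem: "j \<in> c \<longleftrightarrow> E i ?s j True = b'" if "j < 5" "j \<noteq> i" for j
    using c'(2) E[OF that] by (auto simp: b'_def)
  have "c - {i} = (if b' then out_choice i ?s else in_choice i ?s)"
    using mem \<open>c \<subseteq> {..<5}\<close> by (auto simp: out_choice_def in_choice_def)
  then have "c - {i} = out_choice i ?s \<or> c - {i} = in_choice i ?s" by (simp split: if_splits)
  then have "c \<in> blocks i ?s"
    using m unfolding blocks_def by (cases "i \<in> c") (auto simp: insert_absorb)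
  then show ?thesis using i by blast
qed

lemma card_blocks: "card (blocks i s) \<le> 4"
  unfolding blocks_def by (auto simp: card_insert_if)

lemma finite_blocks: "finite (blocks i s)"
  unfolding blocks_def by auto

text \<open>The 32 subsets are covered by five families of size at most 8, so some family has more
  than 4 members. The inequality between \<open>in_choice i True\<close> and
  \<open>out_choice i False\<close> says that the two vertices of part \<open>i\<close> do not have
  opposite out-choices; if they had, they would block the same sets.\<close>

lemma special_part:
  assumes ext: "\<And>c. extremal E c \<or> extremal E (- c)"
  shows "\<exists>p<5. (\<forall>s. \<not> mixed p s) \<and>
    (\<forall>i<5. i \<noteq> p \<longrightarrow> (\<forall>s. mixed i s) \<and> in_choice i True \<noteq> out_choice i False)"
proof -
  let ?K = "\<lambda>i. blocks i True \<union> blocks i False"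
  have "Pow {..<5} \<subseteq> (\<Union>i<5. ?K i)"
  proof
    fix c :: "nat set" assume "c \<in> Pow {..<5}"
    then obtain i s where "i < 5" "c \<in> blocks i s"
      using extremal_imp_blocks[of c] ext by blast
    then show "c \<in> (\<Union>i<5. ?K i)" by (cases s) auto
  qed
  then have "card (Pow {..<5::nat}) \<le> card (\<Union>i<5. ?K i)"
    by (intro card_mono) (auto simp: finite_blocks)
  also have "\<dots> \<le> (\<Sum>i<5. card (?K i))" by (rule card_UN_le) simp
  finally have total: "32 \<le> (\<Sum>i<5. card (?K i))" by (simp add: card_Pow)
  have K8: "card (?K i) \<le> 8" for i
    using card_Un_le[of "blocks i True" "blocks i False"] card_blocks[of i True] card_blocks[of i False]
    by linarith
  \<comment> \<open>One vertex blocks at most 4 choices, so more than 4 for the part needs both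
    vertices mixed and their families different.\<close>
  have full: "mixed i s \<and> in_choice i True \<noteq> out_choice i False" if "4 < card (?K i)" "i < 5" for i s
  proof -
    have m: "mixed i s" for s
    proof (rule ccontr)
      assume "\<not> mixed i s"
      then have "blocks i s = {}" by (simp add: blocks_def)
      then have "?K i = blocks i (\<not> s)" by (cases s) auto
      then show False using that card_blocks[of i "\<not> s"] by simp
    qed
    moreover have "in_choice i True \<noteq> out_choice i False"
    proof
      assume eq: "in_choice i True = out_choice i False"
      then have "in_choice i False = out_choice i True"
        unfolding in_choice_def out_choice_def by blast
      then have "?K i = blocks i True" using m eq by (auto simp: blocks_def)
      then show False using that card_blocks[of i True] by simp
    qed
    ultimately show ?thesis by blast
  qed
  have "\<exists>i<5. 4 < card (?K i)"
  proof (rule ccontr)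
    assume "\<not> ?thesis"
    then have "(\<Sum>i<5. card (?K i)) \<le> (\<Sum>i<5::nat. 4)" by (intro sum_mono) auto
    then show False using total by simp
  qed
  then obtain i where i: "i < 5" "4 < card (?K i)" by blast
  have mi: "mixed i s" for s using full i by blast
  have "in_choice i True \<noteq> out_choice i False" using full i by blast
  \<comment> \<open>Out-choices that are not opposite agree at some part \<open>p\<close>: both
    vertices of part \<open>i\<close> dominate the same vertex of \<open>p\<close>. Each vertex of
    \<open>p\<close> then has the same direction towards both vertices of part \<open>i\<close>, so
    it is not mixed.\<close>
  then obtain p where p: "p < 5" "p \<noteq> i" "E i True p True = E i False p True"
    unfolding in_choice_def out_choice_def by blast
  have eqF: "E i True p False = E i False p False" using mi p unfolding mixed_def by blast
  have np: "\<not> mixed p s" for s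
  proof
    assume "mixed p s"
    then have "E p s i True \<noteq> E p s i False" using i p by (auto simp: mixed_def)
    then show False
      using anti[of p i s True] anti[of p i s False] p i eqF
      by (cases s) auto
  qed
  have "?K p = {}" by (simp add: blocks_def np)
  then have total': "32 \<le> (\<Sum>i\<in>{..<5} - {p}. card (?K i))"
    using total p(1) by (simp add: sum.remove[of _ p])
  \<comment> \<open>With \<open>p\<close> contributing nothing, another part with at most 4 would
    leave at most 4 + 3 * 8 = 28 < 32 choices.\<close>
  have big: "4 < card (?K j)" if "j < 5" "j \<noteq> p" for j
  proof (rule ccontr)
    assume small: "\<not> ?thesis"
    have "(\<Sum>i\<in>{..<5} - {p}. card (?K i)) = card (?K j) + (\<Sum>i\<in>{..<5} - {p} - {j}. card (?K i))"
      using that by (intro sum.remove) auto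
    also have "(\<Sum>i\<in>{..<5} - {p} - {j}. card (?K i)) \<le> (\<Sum>i\<in>{..<5} - {p} - {j}. 8)"
      by (intro sum_mono K8)
    also have "\<dots> = 24" using that p(1) by simp
    finally show False using total' small by linarith
  qed
  show ?thesis using p(1) np full big by blast
qed


text \<open>The remaining freedom is a permutation \<open>\<sigma>\<close> of the parts and a swap
  of the two vertices inside a part; \<open>s = f i\<close> leaves \<open>s\<close> alone if
  \<open>f i\<close> holds and negates it otherwise.\<close>

lemma canonical_form:
  assumes ext: "\<And>c. extremal E c \<or> extremal E (- c)"
  shows "\<exists>\<sigma> f. bij_betw \<sigma> {..<5} {..<5} \<and>
    (\<forall>i<5. \<forall>j<5. \<forall>s t. E (\<sigma> i) (s = f i) (\<sigma> j) (t = f j) = canonical i s j t)"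
proof -
  obtain p where p: "p < 5" "\<And>s. \<not> mixed p s"
    and mixed: "\<And>i s. \<lbrakk>i < 5; i \<noteq> p\<rbrakk> \<Longrightarrow> mixed i s"
    and choice: "\<And>i. \<lbrakk>i < 5; i \<noteq> p\<rbrakk> \<Longrightarrow> in_choice i True \<noteq> out_choice i False"
    using special_part[OF ext] by blast
  define Q where "Q = {..<5} - {p}"
  define G where "G i j = E i True j True" for i j
  define d where "d i = E i True p True" for i
  have Q5: "i < 5" "i \<noteq> p" if "i \<in> Q" for i using that by (auto simp: Q_def)
  \<comment> \<open>Both ends are mixed, so the four arcs between the two parts form a directed
    4-cycle and one truth value describes them.\<close>
  have EQ: "E i s j t \<longleftrightarrow> G i j = (s = t)" if "i \<in> Q" "j \<in> Q" "i \<noteq> j" for i j s t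
  proof -
    have "E i s j True \<noteq> E i s j False" for s
      using mixed[of i s] that by (auto simp: mixed_def Q_def)
    moreover have "E j True i True \<noteq> E j True i False"
      using mixed[of j True] that by (auto simp: mixed_def Q_def)
    then have "E i True j True \<noteq> E i False j True"
      using anti[of i j True True] anti[of i j False True] that Q5 by blast
    ultimately show ?thesis unfolding G_def by (cases s; cases t) auto
  qed
  have Ep: "E i s p t \<longleftrightarrow> t = d i" if i: "i \<in> Q" for i s t
  proof -
    \<comment> \<open>The out-choices of part \<open>i\<close> agree somewhere. By \<open>EQ\<close>
      they disagree at every part of \<open>Q\<close>, so they agree at \<open>p\<close>: both
      vertices of part \<open>i\<close> dominate vertex \<open>d i\<close> of
      \<open>p\<close>.\<close>
    obtain k where k: "k < 5" "k \<noteq> i" "E i True k True = E i False k True"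
      using choice[of i] Q5[OF i] unfolding in_choice_def out_choice_def by blast
    then have "k = p" using EQ[of i k True True] EQ[of i k False True] i
      by (auto simp: Q_def)
    moreover have "E i s p True \<noteq> E i s p False" for s
      using mixed[of i s] Q5[OF i] p(1) by (auto simp: mixed_def)
    ultimately show ?thesis using k(3) unfolding d_def by (cases s; cases t) auto
  qed
  have pE: "E p s i t \<longleftrightarrow> s \<noteq> d i" if "i \<in> Q" for i s t
    using Ep[OF that, of t s] anti[of p i s t] Q5[OF that] p(1) by auto
  \<comment> \<open>Vertex \<open>s\<close> of \<open>p\<close> dominates both vertices of a part or
    neither, so its out-degree 4 comes from exactly two parts.\<close>
  have card2: "card {i \<in> Q. d i \<noteq> s} = 2" for s
  proof -
    have "(4::nat) = (\<Sum>j\<in>Q. of_bool (E p s j True) + of_bool (E p s j False))"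
      using out4[OF p(1), of s] p(1) by (simp add: sum.remove[of _ p] irrefl Q_def)
    also have "\<dots> = (\<Sum>j\<in>Q. 2 * of_bool (d j \<noteq> s) :: nat)"
      by (intro sum.cong) (auto simp: pE)
    also have "\<dots> = 2 * card {i \<in> Q. d i \<noteq> s}"
      by (simp add: sum_distrib_left[symmetric] Q_def Collect_conj_eq[symmetric] Int_def)
    finally show ?thesis by simp
  qed
  obtain q0 q1 where q01: "{i \<in> Q. d i} = {q0, q1}" "q0 \<noteq> q1"
    using card2[of False] by (auto simp: card_2_iff)
  obtain a b where ab: "{i \<in> Q. \<not> d i} = {a, b}" "a \<noteq> b"
    using card2[of True] by (auto simp: card_2_iff)
  have Q: "Q = {q0, q1, a, b}" using q01(1) ab(1) by blast
  have d: "d q0" "d q1" "\<not> d a" "\<not> d b" using q01(1) ab(1) by blast+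
  have dist: "distinct [q0, q1, a, b]" using q01(2) ab(2) d by auto
  \<comment> \<open>Swapping the vertices of one part reverses its value of \<open>G\<close> against
    every other part of \<open>Q\<close>. This \<open>f\<close> makes \<open>q0\<close> a source of
    the switched tournament \<open>H\<close> on \<open>Q\<close>, while the names in
    \<open>q0\<close> and \<open>p\<close> are kept.\<close>
  define f where "f i = (if i = q0 \<or> i = p then True else G q0 i)" for i
  define H where "H i j \<longleftrightarrow> G i j = (f i = f j)" for i j
  have EH: "E i (s = f i) j (t = f j) \<longleftrightarrow> H i j = (s = t)" if "i \<in> Q" "j \<in> Q" "i \<noteq> j" for i j s t
    unfolding EQ[OF that] H_def by auto
  have H_anti: "H j i \<longleftrightarrow> \<not> H i j" if "i \<in> Q" "j \<in> Q" "i \<noteq> j" for i j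
    using anti[of i j True True] that Q5 unfolding H_def G_def by auto
  have H0: "H q0 i" if "i \<in> Q" "i \<noteq> q0" for i
    using that Q5 unfolding H_def f_def by auto
  \<comment> \<open>Here \<open>x\<close> is a choice in the new names. A source or sink is mixed
    and so lies in a part of \<open>Q\<close>; only its arcs to the other parts of \<open>Q\<close>
    are recorded.\<close>
  have blocked: "\<exists>i\<in>Q. \<forall>j\<in>Q - {i}. \<forall>k\<in>Q - {i}. (H i j = x j) = (H i k = x k)" for x
  proof -
    define c where "c = {i. x i = f i}"
    obtain c' where c': "extremal E c'" "c' = c \<or> c' = - c" using ext[of c] by blast
    then obtain i u where i: "i < 5" and u: "\<And>j. \<lbrakk>j < 5; j \<noteq> i\<rbrakk> \<Longrightarrow> E i (i \<in> c') j (j \<in> c') = u"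
      unfolding extremal_def by blast
    have "mixed i (i \<in> c')" by (rule mixed_if_constant[OF i, of _ "\<lambda>j. j \<in> c'" u]) (rule u)
    then have iQ: "i \<in> Q" using i p(2) unfolding Q_def by blast
    have G: "(G i j = (j \<in> c')) = ((i \<in> c') = u)" if "j \<in> Q - {i}" for j
      using u[of j] EQ[of i j] iQ that Q5[of j] by auto
    have c'_iff: "j \<in> c' \<longleftrightarrow> (x j = f j) = (c' = c)" for j
      using c'(2) unfolding c_def by (cases "c' = c") auto
    have "(H i j = x j) = ((f i = (i \<in> c')) = (u = (c' = c)))" if "j \<in> Q - {i}" for j
      using G[OF that] c'_iff[of j] unfolding H_def
      by (cases "x j"; cases "f j"; cases "f i"; cases u; cases "c' = c"; cases "G i j") simp_all
    then show ?thesis using iQ by blast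
  qed
  have cyc: "H q1 b = (\<not> H q1 a) \<and> H a b = H q1 a"
  proof (rule bool_cyclic)
    fix x0 x1 x2 x3
    show "(x1 = x2 \<and> x2 = x3) \<or>
      ((\<not> x0) = (H q1 a = x2) \<and> (H q1 a = x2) = (H q1 b = x3)) \<or>
      ((\<not> x0) = ((\<not> H q1 a) = x1) \<and> ((\<not> H q1 a) = x1) = (H a b = x3)) \<or>
      ((\<not> x0) = ((\<not> H q1 b) = x1) \<and> ((\<not> H q1 b) = x1) = ((\<not> H a b) = x2))"
    proof -
      \<comment> \<open>The default \<open>x3\<close> serves \<open>b\<close>; values outside
        \<open>Q\<close> do not matter to \<open>blocked\<close>.\<close>
      define x where "x = (\<lambda>i. if i = q0 then x0 else if i = q1 then x1 else if i = a then x2 else x3)"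
      have x: "x q0 = x0" "x q1 = x1" "x a = x2" "x b = x3" using dist by (auto simp: x_def)
      have mem: "q0 \<in> Q" "q1 \<in> Q" "a \<in> Q" "b \<in> Q" by (auto simp: Q)
      have ne: "q0 \<noteq> q1" "q0 \<noteq> a" "q0 \<noteq> b" "q1 \<noteq> a" "q1 \<noteq> b" "a \<noteq> b" using dist by auto
      have H: "H q0 q1" "H q0 a" "H q0 b" "\<not> H q1 q0" "\<not> H a q0" "\<not> H b q0"
        "H a q1 \<longleftrightarrow> \<not> H q1 a" "H b q1 \<longleftrightarrow> \<not> H q1 b" "H b a \<longleftrightarrow> \<not> H a b"
        using H0 H_anti mem ne by metis+
      obtain i where i: "i \<in> Q"
        and eq: "\<And>j k. \<lbrakk>j \<in> Q; j \<noteq> i; k \<in> Q; k \<noteq> i\<rbrakk> \<Longrightarrow> (H i j = x j) = (H i k = x k)"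
        using blocked[of x] by blast
      from i consider "i = q0" | "i = q1" | "i = a" | "i = b" unfolding Q by blast
      then show ?thesis
      proof cases
        case 1
        then show ?thesis using eq[of q1 a] eq[of a b] mem ne H x by auto
      next
        case 2
        then show ?thesis using eq[of q0 a] eq[of a b] mem ne H x by auto
      next
        case 3
        then show ?thesis using eq[of q0 q1] eq[of q1 b] mem ne H x by auto
      next
        case 4
        then show ?thesis using eq[of q0 q1] eq[of q1 a] mem ne H x by auto
      qed
    qed
  qed
  \<comment> \<open>By \<open>cyc\<close>, the parts \<open>q1\<close>, \<open>a\<close>,
    \<open>b\<close> form a 3-cycle of \<open>H\<close> in one of two directions. As
    \<open>d\<close> does not distinguish \<open>a\<close> from \<open>b\<close>, the out-neighbour
    of \<open>q1\<close> may be called \<open>q2\<close>.\<close>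
  have result: ?thesis if q23: "{q2, q3} = {a, b}" and H12: "H q1 q2" for q2 q3
  proof -
    define \<sigma> where "\<sigma> = (\<lambda>i. [q0, q1, q2, q3, p] ! i)"
    have q23': "q2 = a \<and> q3 = b \<or> q2 = b \<and> q3 = a" using q23 by (auto simp: doubleton_eq_iff)
    have q: "Q = {q0, q1, q2, q3}" using q23' Q by auto
    have dq: "\<not> d q2" "\<not> d q3" using q23' d by auto
    have dist': "distinct [q0, q1, q2, q3, p]" using q23' dist Q Q5(2) by auto
    then have ne: "q0 \<noteq> q1" "q0 \<noteq> q2" "q0 \<noteq> q3" "q1 \<noteq> q2" "q1 \<noteq> q3" "q2 \<noteq> q3" by auto
    have mem: "q0 \<in> Q" "q1 \<in> Q" "q2 \<in> Q" "q3 \<in> Q" by (auto simp: q)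
    have H13: "\<not> H q1 q3" "H q2 q3"
      using q23' cyc H12 H_anti[of q2 q3] mem ne by auto
    have Hq: "H q0 q1" "H q0 q2" "H q0 q3" "H q3 q1" "\<not> H q1 q0" "\<not> H q2 q0" "\<not> H q3 q0"
      "\<not> H q2 q1" "\<not> H q3 q2"
      using H0 H_anti mem ne H12 H13 by metis+
    have lt4: "i < 4 \<longleftrightarrow> i = 0 \<or> i = 1 \<or> i = 2 \<or> i = 3" for i :: nat by auto
    have \<sigma>: "\<sigma> 0 = q0" "\<sigma> (Suc 0) = q1" "\<sigma> 2 = q2" "\<sigma> 3 = q3" "\<sigma> 4 = p"
      by (simp_all add: \<sigma>_def)
    have \<sigma>Q: "\<sigma> i \<in> Q" if "i < 4" for i using that mem unfolding lt4 by (auto simp: \<sigma>)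
    have d\<sigma>: "d (\<sigma> i) = (i < 2)" if "i < 4" for i
      using that d dq unfolding lt4 by (auto simp: \<sigma>)
    have H\<sigma>: "\<sigma> i \<noteq> \<sigma> j \<and>
      H (\<sigma> i) (\<sigma> j) = ((i, j) \<in> {(0, 1), (0, 2), (0, 3), (1, 2), (2, 3), (3, 1)})"
      if "i < 4" "j < 4" "i \<noteq> j" for i j
      using that Hq H12 H13 ne unfolding lt4 by (elim disjE) (simp_all add: \<sigma>)
    show ?thesis
    proof (intro exI[of _ \<sigma>] exI[of _ "\<lambda>i. f (\<sigma> i)"] conjI allI impI)
      have "{q0, q1, q2, q3, p} = {..<5}" using q p(1) unfolding Q_def by auto
      then show bij: "bij_betw \<sigma> {..<5} {..<5}"
        unfolding \<sigma>_def by (intro bij_betw_nth[OF dist']) auto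
      fix i j :: nat and s t assume ij: "i < 5" "j < 5"
      have fp: "f p" by (simp add: f_def)
      have "i = 4 \<or> i < 4" "j = 4 \<or> j < 4" using ij by auto
      then consider "i = j" | "i = 4" "j < 4" | "i < 4" "j = 4" | "i < 4" "j < 4" "i \<noteq> j" by blast
      then show "E (\<sigma> i) (s = f (\<sigma> i)) (\<sigma> j) (t = f (\<sigma> j)) = canonical i s j t"
      proof cases
        case 1
        then show ?thesis using irrefl bij_betwE[OF bij] ij by (auto simp: canonical_def)
      next
        case 2
        then show ?thesis using pE[OF \<sigma>Q[of j]] d\<sigma>[of j] fp by (simp add: canonical_def \<sigma>)
      next
        case 3
        then show ?thesis using Ep[OF \<sigma>Q[of i]] d\<sigma>[of i] fp by (simp add: canonical_def \<sigma>)
      next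
        case 4
        then have "E (\<sigma> i) (s = f (\<sigma> i)) (\<sigma> j) (t = f (\<sigma> j)) \<longleftrightarrow> H (\<sigma> i) (\<sigma> j) = (s = t)"
          using H\<sigma>[of i j] by (intro EH \<sigma>Q) auto
        with 4 H\<sigma>[of i j] show ?thesis by (simp only: canonical_def) simp
      qed
    qed
  qed
  show ?thesis
  proof (cases "H q1 a")
    case True
    then show ?thesis by (intro result[of a b]) simp_all
  next
    case False
    then show ?thesis using cyc by (intro result[of b a]) auto
  qed
qed

end

subsection \<open>Labelled tournaments\<close>

text \<open>Without a sink, two steps from any vertex stay in the set and visit three distinct
  vertices. Applied to the converse relation, it yields a source.\<close>

lemma ex_sink_card_le_2:
  assumes "finite S" "S \<noteq> {}" "card S \<le> 2" "irrefl r" "asym_on S r"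
  shows "\<exists>x\<in>S. \<forall>y\<in>S. (x, y) \<notin> r"
proof (rule ccontr)
  assume "\<not> ?thesis"
  then have out: "\<And>x. x \<in> S \<Longrightarrow> \<exists>y\<in>S. (x, y) \<in> r" by blast
  obtain x where x: "x \<in> S" using assms(2) by blast
  obtain y where y: "y \<in> S" "(x, y) \<in> r" using out[OF x] by blast
  obtain z where z: "z \<in> S" "(y, z) \<in> r" using out[OF y(1)] by blast
  have "z \<noteq> x" "x \<noteq> y" "y \<noteq> z"
    using x y z assms(4,5) by (auto simp: irrefl_def asym_on_def)
  then have "card {x, y, z} = 3" by auto
  moreover have "card {x, y, z} \<le> card S" using x y z assms(1) by (intro card_mono) auto
  ultimately show False using assms(3) by simp
qed

text \<open>If some vertex is not reachable from \<open>u\<close>, no arc leaves the set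
  \<open>S\<close> of vertices reachable from \<open>u\<close>. As the order is 5, \<open>S\<close>
  or its complement has at most two vertices; a sink of a small \<open>S\<close>, or a source of a
  small complement, is one of the whole tournament.\<close>

lemma tournament_5_strongly_connected_iff:
  assumes T: "tournament T" and card: "card (pverts T) = 5"
  shows "strongly_connected (with_proj T) \<longleftrightarrow>
    (\<forall>v\<in>pverts T. (\<exists>u\<in>pverts T. (u, v) \<in> parcs T) \<and> (\<exists>u\<in>pverts T. (v, u) \<in> parcs T))"
proof -
  let ?V = "pverts T" and ?r = "parcs T"
  interpret pair_digraph T using T by (simp add: tournament_def)
  have arc: "(u, v) \<in> ?r \<longleftrightarrow> (v, u) \<notin> ?r" if "u \<in> ?V" "v \<in> ?V" "u \<noteq> v" for u v
    using T that unfolding tournament_def by blast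
  have irr: "irrefl ?r" using pair_no_loops by (force simp: irrefl_def)
  have nsym: "(v, u) \<notin> ?r" if "(u, v) \<in> ?r" for u v
    using that arc[of u v] irr in_arcsD1[OF that] in_arcsD2[OF that] by (auto simp: irrefl_def)
  have fin: "finite ?V" by (rule pair_finite_verts)
  show ?thesis
  proof
    assume sc: "strongly_connected (with_proj T)"
    show "\<forall>v\<in>?V. (\<exists>u\<in>?V. (u, v) \<in> ?r) \<and> (\<exists>u\<in>?V. (v, u) \<in> ?r)"
    proof
      fix v assume v: "v \<in> ?V"
      have "\<not> ?V \<subseteq> {v}" using card card_mono[of "{v}" ?V] by auto
      then obtain w where w: "w \<in> ?V" "w \<noteq> v" by blast
      have "(v, w) \<in> ?r\<^sup>*" "(w, v) \<in> ?r\<^sup>*"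
        using sc v w reachable_rtranclI[of "with_proj T"] by (auto simp: strongly_connected_def)
      then show "(\<exists>u\<in>?V. (u, v) \<in> ?r) \<and> (\<exists>u\<in>?V. (v, u) \<in> ?r)"
        using w(2) in_arcsD1 in_arcsD2 by (metis converse_rtranclE rtranclE)
    qed
  next
    assume deg: "\<forall>v\<in>?V. (\<exists>u\<in>?V. (u, v) \<in> ?r) \<and> (\<exists>u\<in>?V. (v, u) \<in> ?r)"
    show "strongly_connected (with_proj T)"
    proof (rule ccontr)
      assume "\<not> ?thesis"
      moreover have "?V \<noteq> {}" using card by auto
      ultimately obtain u v where uv: "u \<in> ?V" "v \<in> ?V" "\<not> u \<rightarrow>\<^sup>*\<^bsub>with_proj T\<^esub> v"
        by (auto simp: strongly_connected_def)
      define S where "S = {w \<in> ?V. u \<rightarrow>\<^sup>*\<^bsub>with_proj T\<^esub> w}"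
      have S: "S \<subseteq> ?V" "u \<in> S" "v \<in> ?V - S" using uv by (auto simp: S_def)
      have cross: "(x, y) \<notin> ?r" if "x \<in> S" "y \<in> ?V - S" for x y
        using that reachable_adj_trans[of u x y] unfolding S_def by auto
      have asym: "asym_on A ?r" "asym_on A (?r\<inverse>)" if "A \<subseteq> ?V" for A
        using nsym by (auto simp: asym_on_def)
      have "card S + card (?V - S) = 5"
        using S(1) fin card card_mono[OF fin S(1)] by (simp add: card_Diff_subset finite_subset)
      then consider "card S \<le> 2" | "card (?V - S) \<le> 2" by linarith
      then show False
      proof cases
        case 1
        then obtain x where "x \<in> S" "\<forall>y\<in>S. (x, y) \<notin> ?r"
          using ex_sink_card_le_2[of S ?r] S irr asym fin finite_subset by blast
        then show False using deg cross S(1) by blast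
      next
        case 2
        then obtain x where "x \<in> ?V - S" "\<forall>y\<in>?V - S. (x, y) \<notin> ?r\<inverse>"
          using ex_sink_card_le_2[of "?V - S" "?r\<inverse>"] S irr asym(2)[of "?V - S"] fin
          by (auto simp: irrefl_def)
        then show False using deg cross S(1) by blast
      qed
    qed
  qed
qed

lemma card_Collect_bool: "card {t. P t} = of_bool (P True) + of_bool (P False)"
proof -
  have "{t. P t} = (if P True then {True} else {}) \<union> (if P False then {False} else {})"
    by (auto split: if_splits) (metis (full_types))+
  then show ?thesis by (auto simp: card_insert_if)
qed

section \<open>Coordinates on 2-balanced 5-partite tournaments\<close>

text \<open>The lemmas \<open>balanced\<close> and \<open>ex_labelling\<close> show that such a
  labelling exists exactly for the 2-balanced 5-partite tournaments; \<open>E\<close> is the arc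
  pattern it induces.\<close>

locale labelled_tournament =
  fixes D :: "'a pair_pre_digraph" and lab :: "nat \<Rightarrow> bool \<Rightarrow> 'a"
  assumes lab_eq: "\<lbrakk>i < 5; j < 5\<rbrakk> \<Longrightarrow> lab i s = lab j t \<longleftrightarrow> i = j \<and> s = t"
    and pverts_lab: "pverts D = {lab i s | i s. i < 5}"
    and parcs_subset: "parcs D \<subseteq> pverts D \<times> pverts D"
    and no_arc: "i < 5 \<Longrightarrow> (lab i s, lab i t) \<notin> parcs D"
    and arc: "\<lbrakk>i < 5; j < 5; i \<noteq> j\<rbrakk> \<Longrightarrow> (lab i s, lab j t) \<in> parcs D \<longleftrightarrow> (lab j t, lab i s) \<notin> parcs D"
begin

definition E :: "nat \<Rightarrow> bool \<Rightarrow> nat \<Rightarrow> bool \<Rightarrow> bool" where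
  "E i s j t \<longleftrightarrow> (lab i s, lab j t) \<in> parcs D"

definition transversal :: "nat set \<Rightarrow> 'a set" where
  "transversal c = (\<lambda>i. lab i (i \<in> c)) ` {..<5}"

lemma finite_pverts: "finite (pverts D)"
proof -
  have "pverts D = (\<lambda>(i, s). lab i s) ` ({..<5} \<times> UNIV)" unfolding pverts_lab by auto
  then show ?thesis by simp
qed

lemma pair_fin_digraph: "pair_fin_digraph D"
  using parcs_subset finite_pverts finite_subset[OF parcs_subset] by unfold_locales auto

lemma no_loop: "(u, u) \<notin> parcs D"
  using parcs_subset no_arc unfolding pverts_lab by auto

lemma balanced: "balanced_partite_tournament 2 5 D"
proof -
  define part where "part i = {lab i True, lab i False}" for i
  have part: "part i = range (lab i)" for i by (auto simp: part_def UNIV_bool)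
  have inj: "inj_on part {..<5}"
    by (auto simp: inj_on_def part_def doubleton_eq_iff lab_eq)
  have "partition_on (pverts D) (part ` {..<5})"
  proof (rule partition_onI)
    show "\<Union> (part ` {..<5}) = pverts D" unfolding pverts_lab part by auto
    show "disjnt p q" if "p \<in> part ` {..<5}" "q \<in> part ` {..<5}" "p \<noteq> q" for p q
      using that by (auto simp: part disjnt_iff lab_eq)
    show "{} \<notin> part ` {..<5}" by (auto simp: part_def)
  qed
  moreover have "if part i = part j then (u, v) \<notin> parcs D else ((u, v) \<in> parcs D) \<noteq> ((v, u) \<in> parcs D)"
    if ij: "i < 5" "j < 5" and uv: "u \<in> part i" "v \<in> part j" for i j u v
  proof -
    have "part i = part j \<longleftrightarrow> i = j" using ij inj by (auto simp: inj_on_def)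
    moreover obtain s t where "u = lab i s" "v = lab j t" using uv by (auto simp: part)
    ultimately show ?thesis using no_arc[OF ij(1)] arc[OF ij] by auto
  qed
  ultimately have "multipartite_tournament D (part ` {..<5})"
    unfolding multipartite_tournament_def using pair_fin_digraph by blast
  moreover have "card (part ` {..<5}) = 5" using card_image[OF inj] by simp
  moreover have "\<forall>X\<in>part ` {..<5}. card X = 2" by (auto simp: part_def lab_eq card_insert_if)
  ultimately show ?thesis unfolding balanced_partite_tournament_def by blast
qed

lemma card_neighbours:
  assumes "R \<subseteq> pverts D"
  shows "card R = (\<Sum>j<5. of_bool (lab j True \<in> R) + of_bool (lab j False \<in> R))"
proof -
  let ?I = "Sigma {..<5} (\<lambda>j. {t. lab j t \<in> R})"
  have "R = (\<lambda>(j, t). lab j t) ` ?I" using assms unfolding pverts_lab by force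
  moreover have "inj_on (\<lambda>(j, t). lab j t) ?I" by (auto simp: inj_on_def lab_eq)
  ultimately have "card R = card ?I" by (metis card_image)
  also have "\<dots> = (\<Sum>j<5. card {t. lab j t \<in> R})" by (intro card_SigmaI) auto
  finally show ?thesis by (simp only: card_Collect_bool)
qed

text \<open>Every vertex has one arc with each of the 8 vertices outside its part, so equal degrees
  mean out-degree 4.\<close>

lemma regular_iff:
  "regular_digraph D \<longleftrightarrow>
     (\<forall>i<5. \<forall>s. (\<Sum>j<5. of_bool (E i s j True) + of_bool (E i s j False)) = (4::nat))"
proof -
  have "in_degree (with_proj D) (lab i s) = out_degree (with_proj D) (lab i s) \<longleftrightarrow>
      (\<Sum>j<5. of_bool (E i s j True) + of_bool (E i s j False)) = (4::nat)" if i: "i < 5" for i s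
  proof -
    have "out_arcs (with_proj D) (lab i s) = Pair (lab i s) ` {v. (lab i s, v) \<in> parcs D}"
      by (auto simp: out_arcs_def)
    then have "out_degree (with_proj D) (lab i s) = card {v. (lab i s, v) \<in> parcs D}"
      unfolding out_degree_def by (simp add: card_image inj_on_def)
    also have "\<dots> = (\<Sum>j<5. of_bool (E i s j True) + of_bool (E i s j False))"
      using parcs_subset by (subst card_neighbours) (auto simp: E_def)
    finally have out: "out_degree (with_proj D) (lab i s) = \<dots>" .
    have "in_arcs (with_proj D) (lab i s) = (\<lambda>u. (u, lab i s)) ` {u. (u, lab i s) \<in> parcs D}"
      by (auto simp: in_arcs_def)
    then have "in_degree (with_proj D) (lab i s) = card {u. (u, lab i s) \<in> parcs D}"
      unfolding in_degree_def by (simp add: card_image inj_on_def)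
    also have "\<dots> = (\<Sum>j<5. of_bool (E j True i s) + of_bool (E j False i s))"
      using parcs_subset by (subst card_neighbours) (auto simp: E_def)
    finally have "in_degree (with_proj D) (lab i s) + out_degree (with_proj D) (lab i s) =
      (\<Sum>j<5. of_bool (E j True i s) + of_bool (E j False i s) +
        (of_bool (E i s j True) + of_bool (E i s j False)))"
      by (simp only: out sum.distrib)
    also have "\<dots> = (\<Sum>j<5. if j = i then 0 else 2)"
      using i no_arc by (intro sum.cong) (auto simp: E_def arc[of _ i])
    also have "\<dots> = (\<Sum>j\<in>{..<5} - {i}. 2)" by (rule sum.mono_neutral_cong_right) auto
    also have "\<dots> = 8" using i by simp
    finally show ?thesis using out by linarith
  qed
  moreover have "regular_digraph D \<longleftrightarrow>
      (\<forall>i<5. \<forall>s. in_degree (with_proj D) (lab i s) = out_degree (with_proj D) (lab i s))"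
    unfolding regular_digraph_def pverts_lab by blast
  ultimately show ?thesis by simp
qed

section \<open>Maximal tournaments as transversals\<close>

lemma transversal_pverts: "transversal c \<subseteq> pverts D"
  unfolding transversal_def pverts_lab by blast

lemma card_transversal: "card (transversal c) = 5"
  unfolding transversal_def by (subst card_image) (auto simp: inj_on_def lab_eq)

text \<open>A tournament inside \<open>D\<close> contains every arc of \<open>D\<close> between its
  vertices, so \<open>E\<close> determines its arcs. In \<open>extremal\<close>, the value
  \<open>b\<close> is true for a source and false for a sink.\<close>

lemma strongly_connected_transversal:
  assumes "tournament A" "pverts A = transversal c" "parcs A \<subseteq> parcs D"
  shows "strongly_connected (with_proj A) \<longleftrightarrow> \<not> extremal E c"
proof -
  have eq: "(lab i (i \<in> c), lab j (j \<in> c)) \<in> parcs A \<longleftrightarrow> i \<noteq> j \<and> E i (i \<in> c) j (j \<in> c)"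
    if "i < 5" "j < 5" for i j
  proof (cases "i = j")
    case True
    then show ?thesis using assms(3) no_loop by auto
  next
    case False
    have "lab i (i \<in> c) \<in> pverts A" "lab j (j \<in> c) \<in> pverts A"
      using that unfolding assms(2) transversal_def by blast+
    moreover have "lab i (i \<in> c) \<noteq> lab j (j \<in> c)" using False that by (simp add: lab_eq)
    ultimately show ?thesis
      using assms(1,3) arc[OF that False] False unfolding tournament_def E_def by blast
  qed
  define F where "F i j \<longleftrightarrow> E i (i \<in> c) j (j \<in> c)" for i j
  have anti: "F j i \<longleftrightarrow> \<not> F i j" if "i < 5" "j < 5" "i \<noteq> j" for i j
    unfolding F_def E_def using that by (intro arc) auto
  have "strongly_connected (with_proj A) \<longleftrightarrow>
      (\<forall>v\<in>transversal c. (\<exists>u\<in>transversal c. (u, v) \<in> parcs A) \<and> (\<exists>u\<in>transversal c. (v, u) \<in> parcs A))"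
    using tournament_5_strongly_connected_iff[OF assms(1)] card_transversal[of c] assms(2) by simp
  also have "\<dots> \<longleftrightarrow>
      (\<forall>i\<in>{..<5}. (\<exists>j\<in>{..<5}. j \<noteq> i \<and> F j i) \<and> (\<exists>j\<in>{..<5}. i \<noteq> j \<and> F i j))"
    unfolding transversal_def F_def ball_simps bex_simps
    by (intro ball_cong bex_cong conj_cong refl) (auto simp: eq)
  also have "\<dots> \<longleftrightarrow> (\<forall>i<5. \<forall>b. \<exists>j<5. j \<noteq> i \<and> F i j \<noteq> b)"
  proof -
    have "(\<exists>j\<in>{..<5}. j \<noteq> i \<and> F j i) \<longleftrightarrow> (\<exists>j<5. j \<noteq> i \<and> F i j \<noteq> True)" if "i < 5" for i
      using anti[of i] that by auto
    moreover have "(\<exists>j\<in>{..<5}. i \<noteq> j \<and> F i j) \<longleftrightarrow> (\<exists>j<5. j \<noteq> i \<and> F i j \<noteq> False)" for i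
      by auto
    ultimately show ?thesis unfolding all_bool_eq by auto
  qed
  also have "\<dots> \<longleftrightarrow> \<not> extremal E c"
    by (simp only: extremal_def F_def not_ex not_all not_imp de_Morgan_conj de_Morgan_disj
        imp_conv_disj[symmetric] simp_thms)
  finally show ?thesis .
qed

lemma transversal_partition:
  "transversal c \<inter> transversal (- c) = {}" "transversal c \<union> transversal (- c) = pverts D"
proof -
  show "transversal c \<inter> transversal (- c) = {}"
    unfolding transversal_def by (auto simp: lab_eq)
  have "lab i s \<in> transversal c \<union> transversal (- c)" if "i < 5" for i s
    using that unfolding transversal_def by (cases "s = (i \<in> c)") auto
  then show "transversal c \<union> transversal (- c) = pverts D"
    using transversal_pverts unfolding pverts_lab by blast
qed

text \<open>The two vertices of a part are not adjacent, so neither tournament contains both; as the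
  two cover everything, each takes exactly one.\<close>

lemma maximal_partition_transversal:
  assumes "maximal_tournament_partition 5 D A B"
  shows "\<exists>c. pverts A = transversal c \<and> pverts B = transversal (- c)"
proof -
  note mtp = assms[unfolded maximal_tournament_partition_def subgraph_def, simplified]
  have one: "\<not> (lab i True \<in> pverts T \<and> lab i False \<in> pverts T)"
    if "tournament T" "parcs T \<subseteq> parcs D" "i < 5" for T i
    using that no_arc[of i] lab_eq[of i i] unfolding tournament_def by blast
  have A: "lab i False \<in> pverts A \<longleftrightarrow> lab i True \<notin> pverts A"
    and B: "lab i s \<in> pverts B \<longleftrightarrow> lab i s \<notin> pverts A" if "i < 5" for i s
  proof -
    have "lab i s \<in> pverts A \<union> pverts B" for s
      using mtp \<open>i < 5\<close> unfolding pverts_lab by blast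
    then show "lab i False \<in> pverts A \<longleftrightarrow> lab i True \<notin> pverts A"
      "lab i s \<in> pverts B \<longleftrightarrow> lab i s \<notin> pverts A"
      using one[of A i] one[of B i] mtp \<open>i < 5\<close> by blast+
  qed
  define c where "c = {i. lab i True \<in> pverts A}"
  have memA: "lab i s \<in> pverts A \<longleftrightarrow> s = (i \<in> c)" if "i < 5" for i s
    using A[OF that] by (cases s) (auto simp: c_def)
  have mem: "lab i s \<in> transversal c \<longleftrightarrow> s = (i \<in> c)" if "i < 5" for i s c
    using that by (auto simp: transversal_def lab_eq)
  have "(v \<in> pverts A \<longleftrightarrow> v \<in> transversal c) \<and> (v \<in> pverts B \<longleftrightarrow> v \<in> transversal (- c))"
    if v: "v \<in> pverts D" for v
  proof -
    obtain i s where "i < 5" "v = lab i s" using v unfolding pverts_lab by blast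
    then show ?thesis using memA mem B by simp
  qed
  moreover have "pverts A \<subseteq> pverts D" "pverts B \<subseteq> pverts D" using mtp by blast+
  ultimately have "pverts A = transversal c" "pverts B = transversal (- c)"
    using transversal_pverts by blast+
  then show ?thesis by blast
qed

lemma maximal_partition_of_choice:
  "\<exists>A B. maximal_tournament_partition 5 D A B \<and> pverts A = transversal c \<and> pverts B = transversal (- c)"
proof -
  define T where "T c = \<lparr>pverts = transversal c, parcs = parcs D \<inter> transversal c \<times> transversal c\<rparr>" for c
  have fin: "finite (transversal c)" for c by (simp add: transversal_def)
  have T: "pair_digraph (T c)" for c
    using fin no_loop by unfold_locales (auto simp: T_def)
  have tourn: "tournament (T c)" for c
    unfolding tournament_def
  proof (intro conjI ballI impI T)
    fix u v assume uv: "u \<in> pverts (T c)" "v \<in> pverts (T c)" "u \<noteq> v"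
    then obtain i j where ij: "i < 5" "j < 5" and "u = lab i (i \<in> c)" "v = lab j (j \<in> c)"
      unfolding T_def transversal_def by auto
    moreover from this have "i \<noteq> j" using uv(3) by auto
    ultimately show "((u, v) \<in> parcs (T c)) \<noteq> ((v, u) \<in> parcs (T c))"
      using arc[OF ij, of "i \<in> c" "j \<in> c"] uv(1,2) by (simp add: T_def)
  qed
  interpret D: pair_fin_digraph D by (rule pair_fin_digraph)
  have sub: "subgraph (with_proj (T c)) (with_proj D)" for c
  proof -
    interpret T: pair_digraph "T c" by (rule T)
    show ?thesis using transversal_pverts D.wf_digraph_axioms T.wf_digraph_axioms
      by (auto simp: subgraph_def compatible_def T_def)
  qed
  have "maximal_tournament_partition 5 D (T c) (T (- c))"
    using sub tourn transversal_partition card_transversal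
    by (simp add: maximal_tournament_partition_def T_def)
  then show ?thesis by (intro exI[of _ "T c"] exI[of _ "T (- c)"]) (simp add: T_def)
qed

lemma has_strong_partition_iff:
  "has_strong_partition 5 D \<longleftrightarrow> (\<exists>c. \<not> extremal E c \<and> \<not> extremal E (- c))"
proof -
  have key: "strongly_connected (with_proj A) \<and> strongly_connected (with_proj B) \<longleftrightarrow>
      \<not> extremal E c \<and> \<not> extremal E (- c)"
    if "maximal_tournament_partition 5 D A B" "pverts A = transversal c" "pverts B = transversal (- c)"
    for A B c
    using that strongly_connected_transversal[of A c] strongly_connected_transversal[of B "- c"]
    by (simp add: maximal_tournament_partition_def subgraph_def)
  show ?thesis
  proof
    assume "has_strong_partition 5 D"
    then obtain A B where AB: "maximal_tournament_partition 5 D A B"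
      "strongly_connected (with_proj A) \<and> strongly_connected (with_proj B)"
      unfolding has_strong_partition_def by blast
    moreover obtain c where "pverts A = transversal c" "pverts B = transversal (- c)"
      using maximal_partition_transversal[OF AB(1)] by blast
    ultimately show "\<exists>c. \<not> extremal E c \<and> \<not> extremal E (- c)" using key by blast
  next
    assume "\<exists>c. \<not> extremal E c \<and> \<not> extremal E (- c)"
    then obtain c where c: "\<not> extremal E c \<and> \<not> extremal E (- c)" by blast
    obtain A B where AB: "maximal_tournament_partition 5 D A B"
      "pverts A = transversal c" "pverts B = transversal (- c)"
      using maximal_partition_of_choice by blast
    show "has_strong_partition 5 D"
      unfolding has_strong_partition_def using key[OF AB] c AB(1) by blast
  qed
qed

lemma regular_pattern:
  assumes "regular_digraph D"
  shows "regular_pattern E"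
proof
  show "\<not> E i s i t" if "i < 5" for i s t unfolding E_def by (rule no_arc[OF that])
  show "E i s j t \<longleftrightarrow> \<not> E j t i s" if "i < 5" "j < 5" "i \<noteq> j" for i j s t
    unfolding E_def by (rule arc[OF that])
  show "(\<Sum>j<5. of_bool (E i s j True) + of_bool (E i s j False)) = (4::nat)" if "i < 5" for i s
    using assms that unfolding regular_iff by blast
qed

text \<open>This carries out on labels the permutation and the swaps found in
  \<open>canonical_form\<close>.\<close>

lemma relabel:
  assumes "bij_betw \<sigma> {..<5} {..<5}"
  shows "labelled_tournament D (\<lambda>i s. lab (\<sigma> i) (s = f i))"
proof
  have \<sigma>: "\<sigma> i < 5" if "i < 5" for i using bij_betwE[OF assms] that by blast
  have inj: "\<sigma> i = \<sigma> j \<longleftrightarrow> i = j" if "i < 5" "j < 5" for i j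
    using assms that by (auto simp: bij_betw_def inj_on_def)
  show "lab (\<sigma> i) (s = f i) = lab (\<sigma> j) (t = f j) \<longleftrightarrow> i = j \<and> s = t" if "i < 5" "j < 5" for i j s t
    using that \<sigma> inj lab_eq by auto
  show "pverts D = {lab (\<sigma> i) (s = f i) |i s. i < 5}"
  proof -
    have "\<exists>j t. lab i s = lab (\<sigma> j) (t = f j) \<and> j < 5" if i: "i < 5" for i s
    proof -
      obtain j where "j < 5" "i = \<sigma> j" using assms i by (auto simp: bij_betw_def)
      then show ?thesis by (intro exI[of _ j] exI[of _ "s = f j"]) (cases "f j"; simp)
    qed
    then show ?thesis unfolding pverts_lab using \<sigma> by blast
  qed
  show "parcs D \<subseteq> pverts D \<times> pverts D" by (rule parcs_subset)
  show "(lab (\<sigma> i) (s = f i), lab (\<sigma> i) (t = f i)) \<notin> parcs D" if "i < 5" for i s t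
    using that \<sigma> no_arc by blast
  show "(lab (\<sigma> i) (s = f i), lab (\<sigma> j) (t = f j)) \<in> parcs D \<longleftrightarrow>
      (lab (\<sigma> j) (t = f j), lab (\<sigma> i) (s = f i)) \<notin> parcs D"
    if "i < 5" "j < 5" "i \<noteq> j" for i j s t
    using that \<sigma> inj by (intro arc) auto
qed

end

section \<open>Existence of labellings, and isomorphism from equal arc patterns\<close>

lemma ex_labelling:
  assumes "balanced_partite_tournament 2 5 D"
  shows "\<exists>lab. labelled_tournament D lab"
proof -
  obtain P where P: "multipartite_tournament D P" "card P = 5" "\<And>X. X \<in> P \<Longrightarrow> card X = 2"
    using assms by (auto simp: balanced_partite_tournament_def)
  have part: "partition_on (pverts D) P" and D: "pair_fin_digraph D"
    and arcs: "\<And>X Y u v. \<lbrakk>X \<in> P; Y \<in> P; u \<in> X; v \<in> Y\<rbrakk> \<Longrightarrow>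
      if X = Y then (u, v) \<notin> parcs D else ((u, v) \<in> parcs D) \<noteq> ((v, u) \<in> parcs D)"
    using P(1) unfolding multipartite_tournament_def by blast+
  have "finite P" using P(2) card.infinite by fastforce
  then obtain e where e: "bij_betw e {..<5::nat} P"
    using ex_bij_betw_nat_finite[of P] P(2) by (auto simp: atLeast0LessThan)
  have eP: "e i \<in> P" if "i < 5" for i using bij_betwE[OF e] that by blast
  have "\<exists>g. range g = e i \<and> inj (g :: bool \<Rightarrow> 'a)" if i: "i < 5" for i
  proof -
    obtain x y where xy: "e i = {x, y}" "x \<noteq> y" using P(3)[OF eP[OF i]] by (auto simp: card_2_iff)
    then show ?thesis by (intro exI[of _ "\<lambda>s. if s then x else y"]) (auto simp: inj_def UNIV_bool)
  qed
  then obtain lab where lab: "\<And>i. i < 5 \<Longrightarrow> range (lab i) = e i \<and> inj (lab i :: bool \<Rightarrow> 'a)"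
    by metis
  have mem: "lab i s \<in> e i" if "i < 5" for i s using lab[OF that] by blast
  have e_eq: "e i = e j \<longleftrightarrow> i = j" if "i < 5" "j < 5" for i j
    using e that by (auto simp: bij_betw_def inj_on_def)
  have "labelled_tournament D lab"
  proof
    show "lab i s = lab j t \<longleftrightarrow> i = j \<and> s = t" if ij: "i < 5" "j < 5" for i j s t
    proof (cases "i = j")
      case True
      then show ?thesis using lab[OF ij(1)] by (auto simp: inj_eq)
    next
      case False
      then have "e i \<inter> e j = {}"
        using partition_onD2[OF part] eP ij e_eq by (auto simp: disjoint_def)
      then show ?thesis using mem[of i s] mem[of j t] ij False by auto
    qed
    show "pverts D = {lab i s |i s. i < 5}"
    proof -
      have "pverts D = (\<Union>i<5. e i)" using partition_onD1[OF part] e by (simp add: bij_betw_def)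
      also have "\<dots> = (\<Union>i<5. range (lab i))" using lab by auto
      finally show ?thesis by auto
    qed
    show "parcs D \<subseteq> pverts D \<times> pverts D"
      using pair_wf_digraph.wellformed'[OF pair_fin_digraph.axioms(1)[OF D]] by auto
    show "(lab i s, lab i t) \<notin> parcs D" if "i < 5" for i s t
      using arcs[OF eP[OF that] eP[OF that] mem[OF that, of s] mem[OF that, of t]] by simp
    show "(lab i s, lab j t) \<in> parcs D \<longleftrightarrow> (lab j t, lab i s) \<notin> parcs D"
      if "i < 5" "j < 5" "i \<noteq> j" for i j s t
      using arcs[OF eP[OF that(1)] eP[OF that(2)] mem[OF that(1), of s] mem[OF that(2), of t]]
        e_eq[OF that(1,2)] that(3) by argo
  qed
  then show ?thesis by blast
qed

lemma labelled_iso: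
  assumes "labelled_tournament D1 lab1" "labelled_tournament D2 lab2"
    and E: "\<And>i j s t. \<lbrakk>i < 5; j < 5\<rbrakk> \<Longrightarrow>
      labelled_tournament.E D1 lab1 i s j t \<longleftrightarrow> labelled_tournament.E D2 lab2 i s j t"
  shows "digraph_iso (with_proj D1) (with_proj D2)"
proof -
  interpret A: labelled_tournament D1 lab1 by fact
  interpret B: labelled_tournament D2 lab2 by fact
  interpret A': pair_fin_digraph D1 by (rule A.pair_fin_digraph)
  let ?I = "{..<5} \<times> (UNIV :: bool set)"
  \<comment> \<open>The isomorphism matches equal labels: \<open>lab1 i s\<close> goes to
    \<open>lab2 i s\<close>.\<close>
  define g where "g = case_prod lab2 \<circ> the_inv_into ?I (case_prod lab1)"
  have inj1: "inj_on (case_prod lab1) ?I" by (auto simp: inj_on_def A.lab_eq)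
  have g: "g (lab1 i s) = lab2 i s" if "i < 5" for i s
    using the_inv_into_f_f[OF inj1, of "(i, s)"] that by (simp add: g_def)
  have inj: "inj_on g (pverts D1)"
    unfolding A.pverts_lab by (auto simp: inj_on_def g A.lab_eq B.lab_eq)
  have "pverts D1 = case_prod lab1 ` ?I" "pverts D2 = case_prod lab2 ` ?I"
    unfolding A.pverts_lab B.pverts_lab by force+
  then have verts: "pverts D2 = g ` pverts D1"
    by (simp only: image_image) (rule image_cong, auto simp: g)
  have arcs: "parcs D2 = map_prod g g ` parcs D1"
  proof (intro set_eqI iffI)
    fix e assume "e \<in> parcs D2"
    then obtain i j s t where ij: "i < 5" "j < 5" and e: "e = (lab2 i s, lab2 j t)" "(lab2 i s, lab2 j t) \<in> parcs D2"
      using B.parcs_subset unfolding B.pverts_lab by blast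
    then have "(lab1 i s, lab1 j t) \<in> parcs D1" using E unfolding A.E_def B.E_def by blast
    then show "e \<in> map_prod g g ` parcs D1" using ij e g by (metis map_prod_imageI)
  next
    fix e assume "e \<in> map_prod g g ` parcs D1"
    then obtain e' where "e = map_prod g g e'" "e' \<in> parcs D1" by (rule imageE)
    then obtain i j s t where ij: "i < 5" "j < 5" and e: "e = map_prod g g (lab1 i s, lab1 j t)"
      "(lab1 i s, lab1 j t) \<in> parcs D1"
      using A.parcs_subset unfolding A.pverts_lab by blast
    then have "(lab2 i s, lab2 j t) \<in> parcs D2" using E unfolding A.E_def B.E_def by blast
    then show "e \<in> parcs D2" using ij e g by simp
  qed
  define h where "h = \<lparr>iso_verts = g, iso_arcs = map_prod g g, iso_head = snd, iso_tail = fst\<rparr>"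
  have "inj_on (map_prod g g) (parcs D1)"
    using A.parcs_subset map_prod_inj_on[OF inj inj] inj_on_subset by blast
  then have "pre_digraph.digraph_isomorphism (with_proj D1) h"
    unfolding pre_digraph.digraph_isomorphism_def
    using A'.wf_digraph_axioms inj by (simp add: h_def)
  moreover have "with_proj D2 = app_iso h (with_proj D1)"
    by (simp add: with_proj_def app_iso_def h_def verts arcs)
  ultimately show ?thesis unfolding digraph_iso_def by blast
qed

subsection \<open>The extremal tournament\<close>

lemma extremal_cong:
  assumes "\<And>i j s t. \<lbrakk>i < 5; j < 5\<rbrakk> \<Longrightarrow> E i s j t = E' i s j t"
  shows "extremal E c \<longleftrightarrow> extremal E' c"
  unfolding extremal_def by (simp add: assms cong: conj_cong)

lemma canonical_blocked: "extremal canonical c \<or> extremal canonical (- c)"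
proof -
  have ex5: "(\<exists>i<5. P i) \<longleftrightarrow> P 0 \<or> P 1 \<or> P 2 \<or> P 3 \<or> P (4::nat)"
    and all5: "(\<forall>i<5. P i) \<longleftrightarrow> P 0 \<and> P 1 \<and> P 2 \<and> P 3 \<and> P (4::nat)" for P
    by (auto simp: eval_nat_numeral less_Suc_eq)
  show ?thesis
    \<comment> \<open>Only membership of the five part indices matters, which leaves 32
      cases.\<close>
    by (cases "0 \<in> c"; cases "1 \<in> c"; cases "2 \<in> c"; cases "3 \<in> c"; cases "4 \<in> c")
      (simp_all add: extremal_def ex5 all5 ex_bool_eq canonical_def)
qed

text \<open>A realisation of the pattern on natural numbers: part \<open>i\<close> is the pair 2i,
  2i + 1, with the even number as its vertex \<open>True\<close>.\<close>

definition canonical_tournament :: "nat pair_pre_digraph" where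
  "canonical_tournament = \<lparr>pverts = {..<10},
     parcs = {(u, v). u < 10 \<and> v < 10 \<and> canonical (u div 2) (even u) (v div 2) (even v)}\<rparr>"

definition canonical_lab :: "nat \<Rightarrow> bool \<Rightarrow> nat" where
  "canonical_lab i s = (if s then 2 * i else 2 * i + 1)"

lemma canonical_irrefl: "\<not> canonical i s i t"
  by (simp add: canonical_def)

lemma canonical_anti:
  assumes "i < 5" "j < 5" "i \<noteq> j"
  shows "canonical i s j t \<longleftrightarrow> \<not> canonical j t i s"
proof -
  have lt5: "i < 5 \<longleftrightarrow> i = 0 \<or> i = 1 \<or> i = 2 \<or> i = 3 \<or> i = 4" for i :: nat by auto
  show ?thesis
    using assms unfolding lt5 by (elim disjE) (auto simp: canonical_def)
qed

lemma canonical_lab_simps: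
  "canonical_lab i s div 2 = i" "even (canonical_lab i s) = s" "canonical_lab i s < 10 \<longleftrightarrow> i < 5"
  by (auto simp: canonical_lab_def)

lemma canonical_lab_arc:
  assumes "i < 5" "j < 5"
  shows "(canonical_lab i s, canonical_lab j t) \<in> parcs canonical_tournament \<longleftrightarrow> canonical i s j t"
  using assms by (simp add: canonical_tournament_def canonical_lab_simps)

interpretation canonical: labelled_tournament canonical_tournament canonical_lab
proof
  show "canonical_lab i s = canonical_lab j t \<longleftrightarrow> i = j \<and> s = t" for i j s t
    unfolding canonical_lab_def by (cases s; cases t; simp; presburger)
  have "u = canonical_lab (u div 2) (even u)" for u by (simp add: canonical_lab_def)
  then show "pverts canonical_tournament = {canonical_lab i s |i s. i < 5}"
    by (auto simp: canonical_tournament_def canonical_lab_simps)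
       (metis canonical_lab_simps(3))
  show "parcs canonical_tournament \<subseteq> pverts canonical_tournament \<times> pverts canonical_tournament"
    by (auto simp: canonical_tournament_def)
  show "(canonical_lab i s, canonical_lab i t) \<notin> parcs canonical_tournament" if "i < 5" for i s t
    using that by (simp add: canonical_lab_arc canonical_irrefl)
  show "(canonical_lab i s, canonical_lab j t) \<in> parcs canonical_tournament \<longleftrightarrow>
      (canonical_lab j t, canonical_lab i s) \<notin> parcs canonical_tournament"
    if "i < 5" "j < 5" "i \<noteq> j" for i j s t
    using that canonical_anti[OF that, of s t] by (simp add: canonical_lab_arc)
qed

lemma canonical_E: "\<lbrakk>i < 5; j < 5\<rbrakk> \<Longrightarrow> canonical.E i s j t = canonical i s j t"
  by (simp add: canonical.E_def canonical_lab_arc)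

lemma canonical_regular: "regular_digraph canonical_tournament"
proof -
  have lt5: "i < 5 \<longleftrightarrow> i = 0 \<or> i = 1 \<or> i = 2 \<or> i = 3 \<or> i = 4" for i :: nat by auto
  have sum5: "(\<Sum>j<5. g j) = g 0 + g 1 + g 2 + g 3 + g 4" for g :: "nat \<Rightarrow> nat"
    by (simp add: eval_nat_numeral)
  have "(\<Sum>j<5. of_bool (canonical i s j True) + of_bool (canonical i s j False)) = (4::nat)"
    if "i < 5" for i s
    using that unfolding lt5 sum5 by (elim disjE; cases s) (simp_all add: canonical_def)
  then show ?thesis by (simp add: canonical.regular_iff canonical_E)
qed

lemma canonical_not_strong: "\<not> has_strong_partition 5 canonical_tournament"
  using canonical_blocked extremal_cong[OF canonical_E]
  by (simp add: canonical.has_strong_partition_iff)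

section \<open>Uniqueness up to isomorphism\<close>

text \<open>Any two such tournaments thus share one arc pattern, so \<open>labelled_iso\<close>
  makes them isomorphic.\<close>

lemma ex_canonical_labelling:
  assumes "balanced_partite_tournament 2 5 D" "regular_digraph D" "\<not> has_strong_partition 5 D"
  shows "\<exists>lab. labelled_tournament D lab \<and>
    (\<forall>i<5. \<forall>j<5. \<forall>s t. labelled_tournament.E D lab i s j t = canonical i s j t)"
proof -
  obtain lab where "labelled_tournament D lab" using ex_labelling[OF assms(1)] by blast
  then interpret labelled_tournament D lab .
  interpret regular_pattern E by (rule regular_pattern[OF assms(2)])
  have ext: "extremal E c \<or> extremal E (- c)" for c
    using assms(3) by (auto simp: has_strong_partition_iff)
  obtain \<sigma> f where \<sigma>: "bij_betw \<sigma> {..<5} {..<5}"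
    and E: "\<And>i j s t. \<lbrakk>i < 5; j < 5\<rbrakk> \<Longrightarrow> E (\<sigma> i) (s = f i) (\<sigma> j) (t = f j) = canonical i s j t"
    using canonical_form[OF ext] by blast
  let ?lab = "\<lambda>i s. lab (\<sigma> i) (s = f i)"
  interpret R: labelled_tournament D ?lab by (rule relabel[OF \<sigma>])
  have "R.E i s j t = canonical i s j t" if "i < 5" "j < 5" for i j s t
    using E[OF that] by (simp add: R.E_def E_def)
  then show ?thesis using R.labelled_tournament_axioms by blast
qed

theorem theorem3p3:
  shows "(\<exists>D :: nat pair_pre_digraph.
            balanced_partite_tournament 2 5 D \<and> regular_digraph D \<and>
            \<not> has_strong_partition 5 D) \<and>
         (\<forall>(D1 :: 'a pair_pre_digraph) (D2 :: 'b pair_pre_digraph).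
            balanced_partite_tournament 2 5 D1 \<and> regular_digraph D1 \<and>
            \<not> has_strong_partition 5 D1 \<and>
            balanced_partite_tournament 2 5 D2 \<and> regular_digraph D2 \<and>
            \<not> has_strong_partition 5 D2 \<longrightarrow>
            digraph_iso (with_proj D1) (with_proj D2))"
proof (intro conjI allI impI)
  show "\<exists>D :: nat pair_pre_digraph.
      balanced_partite_tournament 2 5 D \<and> regular_digraph D \<and> \<not> has_strong_partition 5 D"
    using canonical.balanced canonical_regular canonical_not_strong by blast
next
  fix D1 :: "'a pair_pre_digraph" and D2 :: "'b pair_pre_digraph"
  assume *: "balanced_partite_tournament 2 5 D1 \<and> regular_digraph D1 \<and>
      \<not> has_strong_partition 5 D1 \<and>
      balanced_partite_tournament 2 5 D2 \<and> regular_digraph D2 \<and>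
      \<not> has_strong_partition 5 D2"
  obtain lab1 where lab1: "labelled_tournament D1 lab1"
    "\<forall>i<5. \<forall>j<5. \<forall>s t. labelled_tournament.E D1 lab1 i s j t = canonical i s j t"
    using ex_canonical_labelling[of D1] * by blast
  obtain lab2 where lab2: "labelled_tournament D2 lab2"
    "\<forall>i<5. \<forall>j<5. \<forall>s t. labelled_tournament.E D2 lab2 i s j t = canonical i s j t"
    using ex_canonical_labelling[of D2] * by blast
  show "digraph_iso (with_proj D1) (with_proj D2)"
    by (rule labelled_iso[OF lab1(1) lab2(1)]) (simp add: lab1(2) lab2(2))
qed

end
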